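(* For $k\ge2$ put $U_k=\mathcal A_k(E_k)$. Suppose there is $K_0$ such that for every $k\ge K_0$, $$|U_k|\le2,$$ and whenever $|U_k|=2$ the two elements of $U_k$ have opposite parity. Suppose also that $0\in U_k$ for arbitrarily large $k$. Then $\Gamma$ is connected.
   Context: $\mathbb N=\{1,2,3,\dots\}$; $\tau(n)$ is the number of positive divisors of $n$; $T(n)=n+\tau(n)$, with iterates $T^s$. $\Gamma$ is the undirected graph with vertex set $\mathbb N$ and edge set $\{\{n,T(n)\}:n\in\mathbb N\}$. For $k\ge1$ the annular transfer map $\mathcal A_k:\{0,1,\dots,2k\}\to\{0,1,\dots,2k+2\}$ is defined as follows: for $0\le r\le 2k$, let $s\ge1$ be minimal with $T^s(k^2+r)\ge (k+1)^2$; then $\mathcal A_k(r)=T^s(k^2+r)-(k+1)^2$. For a set $A$ of offsets, $\mathcal A_k(A)=\{\mathcal A_k(r):r\in A\}$. For $k\ge2$ the exit set is $$E_k=\{\tau(k^2-j)-j:\ 1\le j\le 2k-2,\ \tau(k^2-j)\ge j\}\subseteq\{0,\dots,2k\}.$$ *)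

theory Defs
  imports Complex_Main "Graph_Theory.Digraph_Component"
begin

definition tau :: "nat \<Rightarrow> nat" where
  "tau n = card {d. d dvd n}"

definition T :: "nat \<Rightarrow> nat" where
  "T n = n + tau n"

definition Gamma_edges :: "nat set set" where
  "Gamma_edges = {{n, T n} | n. 1 \<le> n}"

text \<open>The undirected graph is represented by the symmetric digraph that has both
  orientations of every edge; its vertex set is the positive integers.\<close>

definition Gamma :: "nat pair_pre_digraph" where
  "Gamma = \<lparr> pverts = {n. 1 \<le> n}, parcs = {(u, v). {u, v} \<in> Gamma_edges} \<rparr>"

text \<open>Subtraction is on natural numbers but never truncates where these are used:
  for k >= 1 the minimal s exists, see annular_transfer_exit_exists, and for k >= 2 we have
  j <= 2k - 2 < k^2.\<close>

definition annular_transfer :: "nat \<Rightarrow> nat \<Rightarrow> nat" where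
  "annular_transfer k r =
     (let s = (LEAST s. 1 \<le> s \<and> (k + 1)^2 \<le> (T ^^ s) (k^2 + r))
      in (T ^^ s) (k^2 + r) - (k + 1)^2)"

definition exit_set :: "nat \<Rightarrow> nat set" where
  "exit_set k =
     {tau (k^2 - j) - j | j. 1 \<le> j \<and> j \<le> 2 * k - 2 \<and> j \<le> tau (k^2 - j)}"

definition U :: "nat \<Rightarrow> nat set" where
  "U k = annular_transfer k ` exit_set k"

lemma tau_pos: "1 \<le> n \<Longrightarrow> 1 \<le> tau n"
proof -
  assume n: "1 \<le> n"
  then have "finite {d. d dvd n}" by simp
  moreover have "1 \<in> {d. d dvd n}" by simp
  ultimately have "card {d. d dvd n} > 0" by (metis card_gt_0_iff empty_iff)
  then show ?thesis by (simp add: tau_def)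
qed

lemma T_iterate_ge: "1 \<le> n \<Longrightarrow> n + s \<le> (T ^^ s) n"
proof (induction s)
  case 0
  then show ?case by simp
next
  case (Suc s)
  then have "n + s \<le> (T ^^ s) n" and "1 \<le> (T ^^ s) n" by auto
  then show ?case using tau_pos[of "(T ^^ s) n"] by (simp add: T_def[of "(T ^^ s) n"])
qed

lemma annular_transfer_exit_exists:
  assumes "1 \<le> k"
  shows "\<exists>s. 1 \<le> s \<and> (k + 1)^2 \<le> (T ^^ s) (k^2 + r)"
proof -
  have "1 \<le> k^2 + r" using assms by (simp add: Suc_le_eq)
  from T_iterate_ge[OF this, of "(k + 1)^2"]
  have "(k + 1)^2 \<le> (T ^^ ((k + 1)^2)) (k^2 + r)" by linarith
  moreover have "1 \<le> (k + 1)^2" by simp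
  ultimately show ?thesis by blast
qed

lemma Gamma_bidirected: "pair_bidirected_digraph Gamma"
proof unfold_locales
  fix e assume "e \<in> parcs Gamma"
  then obtain u v n where e: "e = (u, v)" "{u, v} = {n, T n}" "1 \<le> n"
    by (auto simp: Gamma_def Gamma_edges_def)
  then have uv: "(u = n \<and> v = T n) \<or> (u = T n \<and> v = n)" by (auto simp: doubleton_eq_iff)
  then show "fst e \<in> pverts Gamma" "snd e \<in> pverts Gamma"
    using e by (auto simp: Gamma_def T_def)
  show "fst e \<noteq> snd e"
    using uv e tau_pos[of n] by (auto simp: T_def)
next
  show "symmetric (with_proj Gamma)"
    by (auto simp: symmetric_def Gamma_def insert_commute intro!: symI)
qed

end

theory Submission
  imports Defs
begin

text \<open>
  Follow the forward orbits of \<^const>\<open>T\<close>. A number below \<open>k\<^sup>2\<close> has at most \<open>2 * (k - 1)\<close>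
  divisors, so no orbit can jump over the annulus from \<open>k\<^sup>2\<close> to \<open>(k + 1)\<^sup>2\<close>: every orbit that
  starts below \<open>k\<^sup>2\<close> enters this annulus at an offset in \<^term>\<open>exit_set k\<close>, and hence the next
  one at an offset in \<^term>\<open>U k\<close> (\<open>orbit_meets_U\<close>).

  The obstruction to merging is parity. The divisor count is odd exactly at squares, so an orbit
  changes parity only when it leaves a square, and inside the annulus the only square is \<open>k\<^sup>2\<close>
  itself, at offset \<open>0\<close>. As consecutive squares have opposite parities, offset \<open>0\<close> and every odd
  offset are transferred to an even offset (\<open>even_annular_transfer_iff\<close>).

  Now let \<open>0 \<in> U k\<close> with \<open>k\<close> large. If \<open>U k\<close> has a further element \<open>y\<close>, then \<open>y\<close> is odd,
  so \<open>0\<close> and \<open>y\<close> are both transferred to even elements of \<^term>\<open>U (k + 1)\<close>. Distinct elements of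
  that set have opposite parities, so the two images coincide (\<open>annular_transfer_merges\<close>). Thus
  all orbits starting below \<open>k\<^sup>2\<close> pass through one common vertex, and since such \<open>k\<close> are
  unbounded, any two vertices are connected.
\<close>

section \<open>The divisor function\<close>

text \<open>In each pair of complementary divisors of a number below \<open>k\<^sup>2\<close>, one is below \<open>k\<close>.\<close>

lemma tau_le_below_square:
  assumes "1 \<le> n" "n < k\<^sup>2"
  shows "tau n \<le> 2 * (k - 1)"
proof -
  have "{d. d dvd n} \<subseteq> {1..<k} \<union> (\<lambda>e. n div e) ` {1..<k}"
  proof
    fix d assume "d \<in> {d. d dvd n}"
    then obtain e where e: "n = d * e" by (auto elim: dvdE)
    with assms have pos: "1 \<le> d" "1 \<le> e" by (auto simp: Suc_le_eq)
    have "d < k \<or> e < k"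
    proof (rule ccontr)
      assume "\<not> ?thesis"
      then have "k * k \<le> d * e" by (intro mult_le_mono) auto
      with assms e show False by (simp add: power2_eq_square)
    qed
    moreover have "d = n div e" using e pos by simp
    ultimately show "d \<in> {1..<k} \<union> (\<lambda>e. n div e) ` {1..<k}" using pos by auto
  qed
  then have "tau n \<le> card ({1..<k} \<union> (\<lambda>e. n div e) ` {1..<k})"
    unfolding tau_def by (intro card_mono) auto
  also have "\<dots> \<le> card {1..<k} + card ((\<lambda>e. n div e) ` {1..<k})"
    by (rule card_Un_le)
  also have "\<dots> \<le> card {1..<k} + card {1..<k}"
    by (intro add_left_mono card_image_le) simp
  finally show ?thesis by simp
qed

text \<open>Complementation pairs the divisors below the square root with those above it, so
  the parity depends only on whether the square root itself is a divisor.\<close>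

lemma odd_tau_iff_square:
  assumes "1 \<le> n"
  shows "odd (tau n) \<longleftrightarrow> (\<exists>m. n = m\<^sup>2)"
proof -
  define S where "S = {d. d dvd n \<and> d * d < n}"
  define L where "L = {d. d dvd n \<and> n < d * d}"
  define M where "M = {d. n = d * d}"
  have fin: "finite {d. d dvd n}" using assms by simp
  have "M \<subseteq> {d. d dvd n}" by (auto simp: M_def)
  with fin have finM: "finite M" by (rule rev_finite_subset)
  have finS: "finite S" and finL: "finite L"
    using fin by (auto simp: S_def L_def)
  have compl: "n div d dvd n" "n div (n div d) = d" "d * (n div d) = n" if "d dvd n" for d
    using that assms by (auto elim!: dvdE)
  have "bij_betw (\<lambda>d. n div d) S L"
  proof (rule bij_betw_byWitness[where f' = "\<lambda>d. n div d"])
    show "\<forall>d\<in>S. n div (n div d) = d" "\<forall>d\<in>L. n div (n div d) = d"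
      by (auto simp: S_def L_def compl)
    show "(\<lambda>d. n div d) ` S \<subseteq> L"
    proof
      fix e assume "e \<in> (\<lambda>d. n div d) ` S"
      then obtain d where d: "d dvd n" "d * d < n" "e = n div d" by (auto simp: S_def)
      then have n: "n = d * e" using compl by simp
      with d(2) have "d < e" by simp
      then have "n < e * e" using n by simp
      with d compl show "e \<in> L" by (simp add: L_def)
    qed
    show "(\<lambda>d. n div d) ` L \<subseteq> S"
    proof
      fix e assume "e \<in> (\<lambda>d. n div d) ` L"
      then obtain d where d: "d dvd n" "n < d * d" "e = n div d" by (auto simp: L_def)
      then have n: "n = d * e" using compl by simp
      with d(2) have "e < d" by simp
      then have "e * e < n" using n assms by simp
      with d compl show "e \<in> S" by (simp add: S_def)
    qed
  qed
  then have SL: "card S = card L" by (rule bij_betw_same_card)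
  have "{d. d dvd n} = (S \<union> L) \<union> M" by (auto simp: S_def L_def M_def)
  then have "tau n = card ((S \<union> L) \<union> M)" by (simp add: tau_def)
  also have "\<dots> = card (S \<union> L) + card M"
    by (rule card_Un_disjoint) (use finS finL finM in \<open>auto simp: S_def L_def M_def\<close>)
  also have "card (S \<union> L) = card S + card L"
    by (rule card_Un_disjoint) (use finS finL in \<open>auto simp: S_def L_def\<close>)
  finally have tau: "tau n = 2 * card L + card M" using SL by simp
  show ?thesis
  proof (cases "\<exists>m. n = m\<^sup>2")
    case True
    then obtain m where "n = m * m" by (auto simp: power2_eq_square)
    then have "M = {m}" by (auto simp: M_def simp flip: power2_eq_square)
    with tau True show ?thesis by simp
  next
    case False
    then have "M = {}" by (auto simp: M_def power2_eq_square)
    with tau False show ?thesis by simp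
  qed
qed

lemma even_tau_between_squares:
  assumes "k\<^sup>2 < n" "n < (k + 1)\<^sup>2"
  shows "even (tau n)"
proof (rule ccontr)
  assume "odd (tau n)"
  with assms obtain m where "n = m\<^sup>2" using odd_tau_iff_square[of n] by auto
  with assms have "k < m" "m < k + 1" by (auto dest: power_less_imp_less_base)
  then show False by simp
qed

section \<open>Orbits enter every annulus\<close>

text \<open>A step across \<open>k\<^sup>2\<close> from \<open>k\<^sup>2 - j\<close> has length at least \<open>j\<close>, so the divisor bound gives
  \<open>j \<le> 2 * k - 2\<close>, which is the range of \<open>j\<close> in the exit set.\<close>

lemma T_crossing_in_exit_set:
  assumes "1 \<le> p" "p < k\<^sup>2" "k\<^sup>2 \<le> T p"
  shows "T p - k\<^sup>2 \<in> exit_set k"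
proof -
  define j where "j = k\<^sup>2 - p"
  have p: "p = k\<^sup>2 - j" using assms by (simp add: j_def)
  have j: "1 \<le> j" "j \<le> tau p" using assms by (auto simp: j_def T_def)
  with tau_le_below_square[OF assms(1,2)] have "j \<le> 2 * k - 2" by simp
  moreover have "T p - k\<^sup>2 = tau (k\<^sup>2 - j) - j" using assms by (simp add: p T_def)
  ultimately show ?thesis using j p unfolding exit_set_def by blast
qed

lemma exit_set_bound:
  assumes "2 \<le> k" "r \<in> exit_set k"
  shows "r \<le> 2 * k"
proof -
  obtain j where j: "r = tau (k\<^sup>2 - j) - j" "1 \<le> j" "j \<le> 2 * k - 2"
    using assms by (auto simp: exit_set_def)
  have "2 * k - 2 < k\<^sup>2"
    using mult_le_mono1[OF assms(1), of k] assms(1) unfolding power2_eq_square by linarith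
  with j have "1 \<le> k\<^sup>2 - j" "k\<^sup>2 - j < k\<^sup>2" by auto
  from tau_le_below_square[OF this] j show ?thesis by linarith
qed

lemma first_passage:
  assumes "1 \<le> n" "n < k\<^sup>2"
  obtains s where "(T ^^ s) n - k\<^sup>2 \<in> exit_set k" "k\<^sup>2 \<le> (T ^^ s) n"
proof -
  define s where "s = (LEAST s. k\<^sup>2 \<le> (T ^^ s) n)"
  have "k\<^sup>2 \<le> (T ^^ (k\<^sup>2)) n" using T_iterate_ge[OF assms(1), of "k\<^sup>2"] by linarith
  then have s: "k\<^sup>2 \<le> (T ^^ s) n" unfolding s_def by (rule LeastI)
  with assms obtain i where i: "s = Suc i" by (cases s) auto
  then have "(T ^^ i) n < k\<^sup>2"
    using not_less_Least[of i "\<lambda>s. k\<^sup>2 \<le> (T ^^ s) n"] by (simp add: s_def)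
  moreover have "1 \<le> (T ^^ i) n" using T_iterate_ge[OF assms(1), of i] assms by linarith
  ultimately have "(T ^^ s) n - k\<^sup>2 \<in> exit_set k"
    using s T_crossing_in_exit_set[of "(T ^^ i) n" k] by (simp add: i)
  with s show thesis by (rule that[rotated])
qed

text \<open>The transfer is split at its last step: up to time \<open>s\<close> the orbit is inside the annulus,
  and step \<open>Suc s\<close> is the crossing.\<close>

lemma annular_transfer_steps:
  assumes "1 \<le> k" "r \<le> 2 * k"
  obtains s where "(T ^^ Suc s) (k\<^sup>2 + r) = (k + 1)\<^sup>2 + annular_transfer k r"
    and "\<And>i. i \<le> s \<Longrightarrow> (T ^^ i) (k\<^sup>2 + r) < (k + 1)\<^sup>2"
proof -
  define P where "P = (\<lambda>s. 1 \<le> s \<and> (k + 1)\<^sup>2 \<le> (T ^^ s) (k\<^sup>2 + r))"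
  define s where "s = (LEAST s. P s)"
  have "\<exists>s. P s" unfolding P_def by (rule annular_transfer_exit_exists[OF assms(1)])
  then have s: "P s" unfolding s_def by (rule LeastI_ex)
  then obtain t where t: "s = Suc t" by (cases s) (auto simp: P_def)
  have "annular_transfer k r = (T ^^ s) (k\<^sup>2 + r) - (k + 1)\<^sup>2"
    by (simp add: annular_transfer_def s_def P_def Let_def)
  with s have 1: "(T ^^ Suc t) (k\<^sup>2 + r) = (k + 1)\<^sup>2 + annular_transfer k r"
    by (simp add: P_def t)
  have 2: "(T ^^ i) (k\<^sup>2 + r) < (k + 1)\<^sup>2" if "i \<le> t" for i
  proof (cases i)
    \<comment> \<open>The transfer map takes at least one step, so minimality says nothing about the
        starting point, which is in the annulus by the bound on \<open>r\<close>.\<close>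
    case 0
    with assms show ?thesis by (simp add: power2_eq_square)
  next
    case (Suc m)
    have "\<not> P i" using that t unfolding s_def by (intro not_less_Least) simp
    with Suc show ?thesis by (simp add: P_def)
  qed
  from 1 2 show thesis by (rule that)
qed

lemma annular_transfer_in_exit_set:
  assumes "1 \<le> k" "r \<le> 2 * k"
  shows "annular_transfer k r \<in> exit_set (k + 1)"
proof -
  obtain s where s: "(T ^^ Suc s) (k\<^sup>2 + r) = (k + 1)\<^sup>2 + annular_transfer k r"
    and below: "\<And>i. i \<le> s \<Longrightarrow> (T ^^ i) (k\<^sup>2 + r) < (k + 1)\<^sup>2"
    using annular_transfer_steps[OF assms] by blast
  have "1 \<le> k\<^sup>2 + r" using assms(1) by (simp add: Suc_le_eq)
  then have "1 \<le> (T ^^ s) (k\<^sup>2 + r)" using T_iterate_ge[of "k\<^sup>2 + r" s] by linarith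
  from T_crossing_in_exit_set[OF this below[OF order_refl]] s show ?thesis by simp
qed

lemma U_subset_exit_set:
  assumes "2 \<le> k"
  shows "U k \<subseteq> exit_set (k + 1)"
  using assms exit_set_bound annular_transfer_in_exit_set by (auto simp: U_def)

lemma finite_U: "finite (U k)"
proof -
  have "exit_set k = (\<lambda>j. tau (k\<^sup>2 - j) - j) ` {j. 1 \<le> j \<and> j \<le> 2 * k - 2 \<and> j \<le> tau (k\<^sup>2 - j)}"
    by (auto simp: exit_set_def)
  then show ?thesis by (simp add: U_def)
qed

lemma orbit_meets_U:
  assumes "2 \<le> k" "1 \<le> n" "n < k\<^sup>2"
  obtains s x where "x \<in> U k" "(T ^^ s) n = (k + 1)\<^sup>2 + x"
proof -
  obtain s where s: "(T ^^ s) n - k\<^sup>2 \<in> exit_set k" "k\<^sup>2 \<le> (T ^^ s) n"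
    using first_passage[OF assms(2,3)] by blast
  define r where "r = (T ^^ s) n - k\<^sup>2"
  have r: "r \<in> exit_set k" "(T ^^ s) n = k\<^sup>2 + r" using s by (simp_all add: r_def)
  have "r \<le> 2 * k" using assms(1) r(1) by (rule exit_set_bound)
  then obtain t where "(T ^^ Suc t) (k\<^sup>2 + r) = (k + 1)\<^sup>2 + annular_transfer k r"
    using annular_transfer_steps[of k r] assms(1) by auto
  then have "(T ^^ (Suc t + s)) n = (k + 1)\<^sup>2 + annular_transfer k r"
    by (simp only: funpow_add comp_apply r(2))
  moreover have "annular_transfer k r \<in> U k" using r by (simp add: U_def)
  ultimately show thesis by (rule that[rotated])
qed

section \<open>Parity and merging\<close>

text \<open>The parity of an orbit changes at the first step if it starts at \<open>k\<^sup>2\<close>, and never again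
  inside the annulus.\<close>

lemma even_annular_transfer_iff:
  assumes "1 \<le> k" "r \<le> 2 * k"
  shows "even (annular_transfer k r) \<longleftrightarrow> r = 0 \<or> odd r"
proof -
  obtain s where s: "(T ^^ Suc s) (k\<^sup>2 + r) = (k + 1)\<^sup>2 + annular_transfer k r"
    and below: "\<And>i. i \<le> s \<Longrightarrow> (T ^^ i) (k\<^sup>2 + r) < (k + 1)\<^sup>2"
    using annular_transfer_steps[OF assms] by blast
  have pos: "1 \<le> k\<^sup>2 + r" using assms(1) by (simp add: Suc_le_eq)
  have first: "even (tau (k\<^sup>2 + r)) \<longleftrightarrow> r \<noteq> 0"
  proof (cases "r = 0")
    case True
    with pos show ?thesis using odd_tau_iff_square[of "k\<^sup>2"] by auto
  next
    case False
    with below[of 0] show ?thesis using even_tau_between_squares[of k "k\<^sup>2 + r"] by simp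
  qed
  have "i \<le> s \<Longrightarrow> even ((T ^^ Suc i) (k\<^sup>2 + r)) \<longleftrightarrow> even (k\<^sup>2 + r + (if r = 0 then 1 else 0))" for i
  proof (induction i)
    case 0
    show ?case using first by (auto simp: T_def)
  next
    case (Suc i)
    define q where "q = (T ^^ Suc i) (k\<^sup>2 + r)"
    have "k\<^sup>2 < q" using T_iterate_ge[OF pos, of "Suc i"] by (simp add: q_def)
    moreover have "q < (k + 1)\<^sup>2" using below[OF Suc.prems] by (simp add: q_def)
    ultimately have "even (tau q)" by (rule even_tau_between_squares)
    then have "even (T q) \<longleftrightarrow> even q" by (simp add: T_def)
    with Suc show ?case by (simp add: q_def)
  qed
  from this[of s] s
  have "even ((k + 1)\<^sup>2 + annular_transfer k r) \<longleftrightarrow> even (k\<^sup>2 + r + (if r = 0 then 1 else 0))"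
    by simp
  then show ?thesis by (auto split: if_splits)
qed

text \<open>If \<open>0\<close> and an odd \<open>x\<close> are the two elements of \<open>U k\<close>, they are transferred to the same
  parity. Both images are entry offsets one annulus later, where the hypothesis separates distinct
  offsets by parity, so they are equal.\<close>

lemma annular_transfer_merges:
  assumes k: "2 \<le> k"
    and hyp: "\<And>l. k \<le> l \<Longrightarrow> card (U l) \<le> 2 \<and>
           (card (U l) = 2 \<longrightarrow> (\<forall>x\<in>U l. \<forall>y\<in>U l. x \<noteq> y \<longrightarrow> even x \<noteq> even y))"
    and zero: "0 \<in> U k" and x: "x \<in> U k"
  shows "annular_transfer (k + 1) x = annular_transfer (k + 1) 0"
proof -
  have parity: "even a \<noteq> even b" if "k \<le> l" "a \<in> U l" "b \<in> U l" "a \<noteq> b" for l a b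
  proof -
    have "card {a, b} \<le> card (U l)" using that finite_U by (intro card_mono) auto
    with that hyp[of l] have "card (U l) = 2" by simp
    with hyp[of l] that show ?thesis by blast
  qed
  have next_annulus: "a \<le> 2 * (k + 1)" "annular_transfer (k + 1) a \<in> U (k + 1)" if "a \<in> U k" for a
  proof -
    have "a \<in> exit_set (k + 1)" using U_subset_exit_set[OF k] that by blast
    then show "a \<le> 2 * (k + 1)" "annular_transfer (k + 1) a \<in> U (k + 1)"
      using exit_set_bound[of "k + 1" a] k by (auto simp: U_def)
  qed
  have "x = 0 \<or> odd x" using parity[of k x 0] x zero by auto
  then have "even (annular_transfer (k + 1) x)"
    using even_annular_transfer_iff[of "k + 1" x] next_annulus(1)[OF x] by simp
  moreover have "even (annular_transfer (k + 1) 0)"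
    using even_annular_transfer_iff[of "k + 1" 0] by simp
  ultimately show ?thesis
    using parity[of "k + 1"] next_annulus(2)[OF x] next_annulus(2)[OF zero] by auto
qed

section \<open>Connectedness\<close>

lemma orbit_reachable_in_Gamma:
  assumes "1 \<le> n"
  shows "n \<rightarrow>\<^sup>*\<^bsub>with_proj Gamma\<^esub> (T ^^ s) n"
proof -
  interpret pair_bidirected_digraph Gamma by (rule Gamma_bidirected)
  show ?thesis
  proof (induction s)
    case 0
    have "n \<in> verts (with_proj Gamma)" using assms by (simp add: Gamma_def)
    then show ?case by simp
  next
    case (Suc s)
    have wf_digraph: "wf_digraph (with_proj Gamma)" by unfold_locales
    have "1 \<le> (T ^^ s) n" using T_iterate_ge[OF assms, of s] assms by linarith
    then have "((T ^^ s) n, (T ^^ Suc s) n) \<in> parcs Gamma"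
      by (auto simp: Gamma_def Gamma_edges_def)
    then have "(T ^^ s) n \<rightarrow>\<^bsub>with_proj Gamma\<^esub> (T ^^ Suc s) n"
      by (simp add: arcs_ends_def arc_to_ends_def)
    with wf_digraph Suc show ?case by (rule wf_digraph.reachable_adj_trans)
  qed
qed

lemma connected_Gamma_if_orbits_meet:
  assumes "\<And>m n. 1 \<le> m \<Longrightarrow> 1 \<le> n \<Longrightarrow> \<exists>s t. (T ^^ s) m = (T ^^ t) n"
  shows "Digraph_Component.connected (with_proj Gamma)"
proof -
  interpret pair_bidirected_digraph Gamma by (rule Gamma_bidirected)
  have wf_digraph: "wf_digraph (with_proj Gamma)" by unfold_locales
  have sym: "symmetric (with_proj Gamma)"
    by (rule sym_arcs)
  have reach: "m \<rightarrow>\<^sup>*\<^bsub>with_proj Gamma\<^esub> n" if "1 \<le> m" "1 \<le> n" for m n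
  proof -
    from assms[OF that] obtain s t where "(T ^^ s) m = (T ^^ t) n" by blast
    then have "m \<rightarrow>\<^sup>*\<^bsub>with_proj Gamma\<^esub> (T ^^ t) n"
      using orbit_reachable_in_Gamma[OF \<open>1 \<le> m\<close>, of s] by simp
    moreover have "(T ^^ t) n \<rightarrow>\<^sup>*\<^bsub>with_proj Gamma\<^esub> n"
      using sym orbit_reachable_in_Gamma[OF \<open>1 \<le> n\<close>] by (rule symmetric_reachable)
    ultimately show ?thesis by (rule reachable_trans)
  qed
  show ?thesis
    unfolding connected_def
  proof (rule strongly_connectedI)
    show "verts (mk_symmetric (with_proj Gamma)) \<noteq> {}" by (auto simp: Gamma_def)
    show "u \<rightarrow>\<^sup>*\<^bsub>mk_symmetric (with_proj Gamma)\<^esub> v"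
      if "u \<in> verts (mk_symmetric (with_proj Gamma))" "v \<in> verts (mk_symmetric (with_proj Gamma))"
      for u v
    proof -
      have "1 \<le> u" "1 \<le> v" using that by (simp_all add: Gamma_def)
      then have "u \<rightarrow>\<^sup>*\<^bsub>with_proj Gamma\<^esub> v" by (rule reach)
      then show ?thesis
        by (simp only: wf_digraph.reachable_mk_symmetric_eq[OF wf_digraph sym])
    qed
  qed
qed

theorem theorem12p2:
  assumes "\<exists>K0\<ge>2. \<forall>k\<ge>K0. card (U k) \<le> 2 \<and>
             (card (U k) = 2 \<longrightarrow> (\<forall>x\<in>U k. \<forall>y\<in>U k. x \<noteq> y \<longrightarrow> even x \<noteq> even y))"
    and "\<forall>N. \<exists>k\<ge>N. 2 \<le> k \<and> 0 \<in> U k"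
  shows "Digraph_Component.connected (with_proj Gamma)"
proof (rule connected_Gamma_if_orbits_meet)
  fix m n :: nat assume mn: "1 \<le> m" "1 \<le> n"
  obtain K0 where K0: "\<And>k. K0 \<le> k \<Longrightarrow> card (U k) \<le> 2 \<and>
      (card (U k) = 2 \<longrightarrow> (\<forall>x\<in>U k. \<forall>y\<in>U k. x \<noteq> y \<longrightarrow> even x \<noteq> even y))"
    using assms(1) by blast
  obtain k where k: "K0 + m + n \<le> k" "2 \<le> k" and zero: "0 \<in> U k"
    using assms(2) by blast
  have hyp: "card (U l) \<le> 2 \<and>
      (card (U l) = 2 \<longrightarrow> (\<forall>x\<in>U l. \<forall>y\<in>U l. x \<noteq> y \<longrightarrow> even x \<noteq> even y))" if "k \<le> l" for l
    using K0[of l] k(1) that by linarith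
  have meets: "\<exists>s. (T ^^ s) a = (k + 2)\<^sup>2 + annular_transfer (k + 1) 0"
    if a: "1 \<le> a" "a \<le> k" for a
  proof -
    have "a < k\<^sup>2" using a mult_le_mono1[OF k(2), of k] unfolding power2_eq_square by linarith
    then obtain s x where x: "x \<in> U k" "(T ^^ s) a = (k + 1)\<^sup>2 + x"
      using orbit_meets_U[OF k(2) a(1)] by blast
    have "x \<in> exit_set (k + 1)" using U_subset_exit_set[OF k(2)] x(1) by blast
    then have "x \<le> 2 * (k + 1)" using exit_set_bound[of "k + 1" x] k(2) by simp
    then obtain t where "(T ^^ Suc t) ((k + 1)\<^sup>2 + x) = (k + 1 + 1)\<^sup>2 + annular_transfer (k + 1) x"
      using annular_transfer_steps[of "k + 1" x] by auto
    then have "(T ^^ (Suc t + s)) a = (k + 1 + 1)\<^sup>2 + annular_transfer (k + 1) x"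
      by (simp only: funpow_add comp_apply x(2))
    also have "annular_transfer (k + 1) x = annular_transfer (k + 1) 0"
      using k(2) hyp zero x(1) by (rule annular_transfer_merges)
    finally have "(T ^^ (Suc t + s)) a = (k + 2)\<^sup>2 + annular_transfer (k + 1) 0"
      by (simp add: add.assoc)
    then show ?thesis by blast
  qed
  from meets[of m] meets[of n] mn k(1) show "\<exists>s t. (T ^^ s) m = (T ^^ t) n"
    by (metis add_leD1 add_leD2)
qed

end
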